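(* Every isolated group has solvable word problem.
   Context: $F_m$ is the free group of rank $m$, and $\mathcal{G}_m$ is the set of normal subgroups of $F_m$ with the topology induced by the product topology on $\{0,1\}^{F_m}$; a point $N$ represents the marked group $F_m/N$. A group $G$ is isolated if it is finitely generated and, for some $m$ and some normal subgroup $N$ of $F_m$ with $F_m/N\cong G$, the point $N$ is isolated in $\mathcal{G}_m$ (this does not depend on the choice of $m$ and $N$). A finitely generated group $G=F/N$, with $F$ free of finite rank, has solvable word problem if $N$ is a recursive subset of $F$, i.e. both $N$ and $F-N$ are recursively enumerable (independent of the choice of $F$ and $N$). *)

theory Defs
  imports
    "HOL-Algebra.Generated_Groups"
    "HOL-Analysis.Function_Topology"
    "HOL-Library.Nat_Bijection"
begin

section \<open>Free groups of finite rank\<close>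

text \<open>
  The letter \<open>(i, True)\<close> stands for the generator \<open>x\<^sub>i\<close> and
  \<open>(i, False)\<close> for its inverse. Elements of the free group are the reduced words.
\<close>

type_synonym letter = "nat \<times> bool"

definition inv_letter :: "letter \<Rightarrow> letter" where
  "inv_letter x = (fst x, \<not> snd x)"

definition reduced :: "letter list \<Rightarrow> bool" where
  "reduced w \<longleftrightarrow> successively (\<lambda>x y. y \<noteq> inv_letter x) w"

definition red_cons :: "letter \<Rightarrow> letter list \<Rightarrow> letter list" where
  "red_cons x w = (case w of [] \<Rightarrow> [x] | y # v \<Rightarrow> if y = inv_letter x then v else x # w)"

text \<open>If \<open>v\<close> is reduced, this is the free reduction of the concatenation \<open>u @ v\<close>.\<close>

definition word_mult :: "letter list \<Rightarrow> letter list \<Rightarrow> letter list" where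
  "word_mult u v = foldr red_cons u v"

definition free_group :: "nat \<Rightarrow> letter list monoid" where
  "free_group m = \<lparr>carrier = {w. reduced w \<and> fst ` set w \<subseteq> {..<m}}, mult = word_mult, one = []\<rparr>"

lemma inv_letter_inv_letter [simp]: "inv_letter (inv_letter x) = x"
  by (simp add: inv_letter_def)

lemma fst_inv_letter [simp]: "fst (inv_letter x) = fst x"
  by (simp add: inv_letter_def)

lemma reduced_Nil [simp]: "reduced []"
  by (simp add: reduced_def)

lemma reduced_ConsD: "reduced (x # w) \<Longrightarrow> reduced w"
  by (auto simp: reduced_def successively_Cons)

lemma reduced_red_cons: "reduced w \<Longrightarrow> reduced (red_cons x w)"
  by (auto simp: red_cons_def reduced_def successively_Cons split: list.split)

lemma red_cons_reduced: "reduced (x # w) \<Longrightarrow> red_cons x w = x # w"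
  by (auto simp: red_cons_def reduced_def successively_Cons split: list.split)

lemma red_cons_cancel: "reduced w \<Longrightarrow> red_cons x (red_cons (inv_letter x) w) = w"
  by (cases w) (auto simp: red_cons_def reduced_def successively_Cons split: list.split)

lemma set_red_cons: "set (red_cons x w) \<subseteq> insert x (set w)"
  by (auto simp: red_cons_def split: list.split)

lemma word_mult_simps [simp]:
  "word_mult [] w = w" "word_mult (x # u) w = red_cons x (word_mult u w)"
  by (simp_all add: word_mult_def)

lemma reduced_word_mult: "reduced w \<Longrightarrow> reduced (word_mult u w)"
  by (induction u) (auto simp: reduced_red_cons)

lemma set_word_mult: "set (word_mult u w) \<subseteq> set u \<union> set w"
  by (induction u) (use set_red_cons in fastforce)+

lemma word_mult_Nil: "reduced w \<Longrightarrow> word_mult w [] = w"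
proof (induction w)
  case (Cons x w)
  then show ?case
    using reduced_ConsD[of x w] by (simp add: red_cons_reduced)
qed simp

lemma word_mult_red_cons:
  assumes "reduced w"
  shows "word_mult (red_cons x v) w = red_cons x (word_mult v w)"
proof (cases v)
  case (Cons y v')
  then show ?thesis
    using red_cons_cancel[OF reduced_word_mult[OF assms], of x v']
    by (simp add: red_cons_def[of x "y # v'"])
qed (simp add: red_cons_def[of x "[]"])

lemma word_mult_assoc:
  "reduced w \<Longrightarrow> word_mult (word_mult u v) w = word_mult u (word_mult v w)"
  by (induction u) (auto simp: word_mult_red_cons)

lemma word_mult_append: "word_mult (u @ v) w = word_mult u (word_mult v w)"
  by (simp add: word_mult_def)

lemma word_mult_rev_inv:
  assumes "reduced w"
  shows "word_mult (rev (map inv_letter u)) (word_mult u w) = w"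
proof (induction u)
  case (Cons x u)
  then show ?case
    using red_cons_cancel[OF reduced_word_mult[OF assms], of "inv_letter x" u]
    by (simp add: word_mult_append)
qed simp

lemma group_free_group: "group (free_group m)"
proof (rule groupI)
  fix u v assume uv: "u \<in> carrier (free_group m)" "v \<in> carrier (free_group m)"
  have "fst ` set (word_mult u v) \<subseteq> fst ` set u \<union> fst ` set v"
    using set_word_mult[of u v] by blast
  also have "\<dots> \<subseteq> {..<m}"
    using uv by (simp add: free_group_def)
  finally show "u \<otimes>\<^bsub>free_group m\<^esub> v \<in> carrier (free_group m)"
    using uv by (simp add: free_group_def reduced_word_mult)
next
  fix u assume u: "u \<in> carrier (free_group m)"
  let ?v = "word_mult (rev (map inv_letter u)) []"
  have "set ?v \<subseteq> inv_letter ` set u"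
    using set_word_mult[of "rev (map inv_letter u)" "[]"] by simp
  then have "fst ` set ?v \<subseteq> fst ` inv_letter ` set u"
    by (rule image_mono)
  with u have "?v \<in> carrier (free_group m)"
    by (auto simp: free_group_def reduced_word_mult image_image)
  moreover have "word_mult ?v u = []"
    using u word_mult_rev_inv[of "[]" u]
    by (simp add: word_mult_assoc free_group_def word_mult_Nil)
  ultimately show "\<exists>v\<in>carrier (free_group m). v \<otimes>\<^bsub>free_group m\<^esub> u = \<one>\<^bsub>free_group m\<^esub>"
    by (auto simp: free_group_def)
qed (auto simp: free_group_def word_mult_assoc)


section \<open>Isolated groups\<close>

definition finitely_generated :: "('a, 'b) monoid_scheme \<Rightarrow> bool" where
  "finitely_generated G \<longleftrightarrow> (\<exists>S. finite S \<and> S \<subseteq> carrier G \<and> generate G S = carrier G)"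

text \<open>
  A normal subgroup is identified with its indicator function, a point of the power of the
  discrete two-point space \<open>bool\<close> indexed by the free group.
\<close>

definition marked_groups :: "nat \<Rightarrow> letter list set topology" where
  "marked_groups m =
     pullback_topology {N. N \<lhd> free_group m}
       (\<lambda>N. \<lambda>w\<in>carrier (free_group m). w \<in> N)
       (product_topology (\<lambda>_. discrete_topology (UNIV :: bool set)) (carrier (free_group m)))"

lemma topspace_marked_groups: "topspace (marked_groups m) = {N. N \<lhd> free_group m}"
  by (auto simp: marked_groups_def topspace_pullback_topology)

definition isolated_group :: "('a, 'b) monoid_scheme \<Rightarrow> bool" where
  "isolated_group G \<longleftrightarrow> finitely_generated G \<and>
     (\<exists>m N. N \<lhd> free_group m \<and> free_group m Mod N \<cong> G \<and> openin (marked_groups m) {N})"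


section \<open>Recursively enumerable sets\<close>

text \<open>
  Partial recursive functions in Kleene's sense. Programs carry no arity;
  \<open>rec_eval f xs y\<close> means that \<open>f\<close> halts on the arguments \<open>xs\<close> with value \<open>y\<close>.
  The recursion variable of \<open>PrimRec\<close> and the search variable of \<open>Mu\<close> come first.
\<close>

datatype recf = Zero | Succ | Proj nat | Comp recf "recf list" | PrimRec recf recf | Mu recf

inductive rec_eval :: "recf \<Rightarrow> nat list \<Rightarrow> nat \<Rightarrow> bool" where
  Zero: "rec_eval Zero xs 0"
| Succ: "rec_eval Succ [x] (Suc x)"
| Proj: "i < length xs \<Longrightarrow> rec_eval (Proj i) xs (xs ! i)"
| Comp: "list_all2 (\<lambda>g y. rec_eval g xs y) gs ys \<Longrightarrow> rec_eval f ys z \<Longrightarrow>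
    rec_eval (Comp f gs) xs z"
| PrimRec_0: "rec_eval f xs y \<Longrightarrow> rec_eval (PrimRec f g) (0 # xs) y"
| PrimRec_Suc: "rec_eval (PrimRec f g) (n # xs) y \<Longrightarrow> rec_eval g (n # y # xs) z \<Longrightarrow>
    rec_eval (PrimRec f g) (Suc n # xs) z"
| Mu: "rec_eval f (n # xs) 0 \<Longrightarrow> (\<And>k. k < n \<Longrightarrow> \<exists>y. rec_eval f (k # xs) (Suc y)) \<Longrightarrow>
    rec_eval (Mu f) xs n"

inductive_cases rec_eval_ZeroE: "rec_eval Zero xs y"
inductive_cases rec_eval_SuccE: "rec_eval Succ xs y"
inductive_cases rec_eval_ProjE: "rec_eval (Proj i) xs y"
inductive_cases rec_eval_CompE: "rec_eval (Comp f gs) xs y"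
inductive_cases rec_eval_PrimRec_0E: "rec_eval (PrimRec f g) (0 # xs) y"
inductive_cases rec_eval_PrimRec_SucE: "rec_eval (PrimRec f g) (Suc n # xs) y"
inductive_cases rec_eval_MuE: "rec_eval (Mu f) xs y"

lemma rec_eval_functional: "rec_eval f xs y \<Longrightarrow> rec_eval f xs z \<Longrightarrow> y = z"
proof (induction arbitrary: z rule: rec_eval.induct)
  case (Comp xs gs ys f z z')
  from Comp.prems obtain ys' where
    ys': "list_all2 (\<lambda>g y. rec_eval g xs y) gs ys'" "rec_eval f ys' z'"
    by (auto elim: rec_eval_CompE)
  have "ys = ys'"
    using Comp.IH(1) ys'(1) by (auto simp: list_all2_conv_all_nth intro!: nth_equalityI)
  with Comp.IH(2) ys'(2) show ?case by blast
next
  case (Mu f n xs)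
  from Mu.prems have z: "rec_eval f (z # xs) 0" "\<And>k. k < z \<Longrightarrow> \<exists>y. rec_eval f (k # xs) (Suc y)"
    by (auto elim: rec_eval_MuE)
  have "\<not> z < n" using Mu.IH(2) z(1) by fastforce
  moreover have "\<not> n < z" using Mu.IH(1) z(2) by fastforce
  ultimately show ?case by simp
qed (blast elim: rec_eval_ZeroE rec_eval_SuccE rec_eval_ProjE rec_eval_PrimRec_0E
       rec_eval_PrimRec_SucE)+

text \<open>A set of numbers is recursively enumerable if it is the domain of a partial recursive function.\<close>

definition re_set :: "nat set \<Rightarrow> bool" where
  "re_set A \<longleftrightarrow> (\<exists>f. \<forall>n. n \<in> A \<longleftrightarrow> (\<exists>y. rec_eval f [n] y))"

definition word_code :: "letter list \<Rightarrow> nat" where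
  "word_code w = list_encode (map (\<lambda>(i, b). prod_encode (i, of_bool b)) w)"

lemma inj_word_code: "inj word_code"
proof -
  have "inj (\<lambda>(i :: nat, b). prod_encode (i, of_bool b))"
    by (auto simp: inj_def of_bool_def split: if_splits)
  then show ?thesis
    by (auto simp: inj_def word_code_def list_encode_eq inj_map_eq_map)
qed

definition re_words :: "letter list set \<Rightarrow> bool" where
  "re_words A \<longleftrightarrow> re_set (word_code ` A)"

definition recursive_in_free_group :: "nat \<Rightarrow> letter list set \<Rightarrow> bool" where
  "recursive_in_free_group m N \<longleftrightarrow> re_words N \<and> re_words (carrier (free_group m) - N)"


section \<open>Solvable word problem\<close>

text \<open>
  The existential quantifier over \<open>m\<close> and \<open>N\<close>, here as in \<open>isolated_group\<close>, is harmless: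
  both properties do not depend on the presentation of \<open>G\<close> as a quotient of a free group.
\<close>

definition solvable_word_problem :: "('a, 'b) monoid_scheme \<Rightarrow> bool" where
  "solvable_word_problem G \<longleftrightarrow> finitely_generated G \<and>
     (\<exists>m N. N \<lhd> free_group m \<and> free_group m Mod N \<cong> G \<and> recursive_in_free_group m N)"

end

theory Submission
  imports Defs
begin

text \<open>
  Let \<open>N\<close> be an isolated point of the space of normal subgroups of \<open>F = F\<^sub>m\<close>. By the definition
  of the product topology there is a finite set \<open>K \<subseteq> F\<close> such that \<open>N\<close> is the only normal subgroup
  meeting \<open>K\<close> in \<open>N \<inter> K\<close>; this is \<open>open_singleton_finite_test\<close>. Write \<open>P = K \<inter> N\<close> and
  \<open>Q = K - N\<close>, and let \<open>ncl\<close> denote the normal closure in \<open>F\<close>.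

  Since \<open>P \<subseteq> ncl P \<subseteq> N\<close>, the normal subgroup \<open>ncl P\<close> meets \<open>K\<close> in the same set as \<open>N\<close>. Hence
  \<open>N = ncl P\<close>, which is recursively enumerable because \<open>P\<close> is finite. If \<open>w \<in> F - N\<close>, then
  \<open>ncl (P \<union> {w})\<close> differs from \<open>N\<close> although it contains \<open>P\<close>, so it must meet \<open>Q\<close>; if \<open>w \<in> N\<close>,
  then \<open>ncl (P \<union> {w}) \<subseteq> N\<close> does not meet \<open>Q\<close>. So \<open>w \<in> F - N\<close> exactly if some element of the
  finite set \<open>Q\<close> turns up in an enumeration of \<open>ncl (P \<union> {w})\<close>. That enumeration is uniform in
  \<open>w\<close>, and therefore \<open>F - N\<close> is recursively enumerable as well; this is \<open>recursive_if_isolated\<close>.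

  For the enumeration, the normal closure of \<open>R\<close> is described as the orbit of the identity under
  moves \<open>s \<mapsto> u s v\<close> from a finite list: multiplication on the left by an element of \<open>R\<close> or its
  inverse, and conjugation by a letter (\<open>normal_closure_orbit\<close>). A list of numbers, read as
  indices into the list of moves, names an element of the orbit, and every element has such a name
  (\<open>range_run\<close>). Carrying out a named sequence of moves is a fold over a list, so the only
  facts needed about partial recursive functions are that they can handle pairs, case distinctions
  and folds over coded lists (\<open>computable_case_list\<close>, \<open>computable_fold\<close>) and that they can search
  through all names (\<open>re_words_search\<close>).
\<close>

section \<open>Computing with codes\<close>

text \<open>
  The argument \<open>d\<close> turns \<open>x\<close> into the vector of numbers on which the program is run. Leaving the
  type of \<open>x\<close> open makes the notion cover functions of several variables and functions on coded
  data. The program need not halt on vectors outside the range of \<open>d\<close>.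
\<close>

definition computable :: "('a \<Rightarrow> nat list) \<Rightarrow> ('a \<Rightarrow> nat) \<Rightarrow> bool" where
  "computable d f \<longleftrightarrow> (\<exists>p. \<forall>x. rec_eval p (d x) (f x))"

lemma computable_arg:
  assumes "\<And>x. i < length (d x) \<and> d x ! i = f x"
  shows "computable d f"
  unfolding computable_def by (metis assms rec_eval.Proj)

lemma computable_reindex:
  assumes "computable e h" "\<And>x. d x = e (r x)" "\<And>x. f x = h (r x)"
  shows "computable d f"
  using assms by (auto simp: computable_def)

lemma computable_comp:
  assumes "computable e h" "\<And>x. e (r x) = map (\<lambda>g. g x) gs" "\<And>g. g \<in> set gs \<Longrightarrow> computable d g"
  shows "computable d (\<lambda>x. h (r x))"
proof -
  obtain p where p: "\<And>y. rec_eval p (e y) (h y)"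
    using assms(1) by (auto simp: computable_def)
  obtain Q where Q: "\<And>g x. g \<in> set gs \<Longrightarrow> rec_eval (Q g) (d x) (g x)"
    using assms(3) unfolding computable_def by metis
  have "rec_eval (Comp p (map Q gs)) (d x) (h (r x))" for x
  proof (rule rec_eval.Comp)
    show "list_all2 (\<lambda>q y. rec_eval q (d x) y) (map Q gs) (map (\<lambda>g. g x) gs)"
      using Q by (auto simp: list_all2_conv_all_nth)
    show "rec_eval p (map (\<lambda>g. g x) gs) (h (r x))"
      using p[of "r x"] assms(2) by simp
  qed
  then show ?thesis by (auto simp: computable_def)
qed

text \<open>
  In the composition rules the function \<open>c\<close> encodes the intermediate value, which may be of any
  type.
\<close>

lemma computable_comp1:
  assumes "computable (\<lambda>y. [c y]) h" "computable d (\<lambda>x. c (f x))"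
  shows "computable d (\<lambda>x. h (f x))"
  by (rule computable_comp[OF assms(1), where gs = "[\<lambda>x. c (f x)]"]) (use assms in auto)

lemma computable_comp2:
  assumes "computable (\<lambda>z. [c (fst z), c' (snd z)]) (\<lambda>z. h (fst z) (snd z))"
    and "computable d (\<lambda>x. c (f x))" "computable d (\<lambda>x. c' (g x))"
  shows "computable d (\<lambda>x. h (f x) (g x))"
  using computable_comp[OF assms(1), where gs = "[\<lambda>x. c (f x), \<lambda>x. c' (g x)]" and d = d
      and r = "\<lambda>x. (f x, g x)"] assms(2,3) by auto

lemma computable_comp3:
  assumes "computable (\<lambda>z. [c (fst z), c' (fst (snd z)), c'' (snd (snd z))])
      (\<lambda>z. h (fst z) (fst (snd z)) (snd (snd z)))"
    and "computable d (\<lambda>x. c (f x))" "computable d (\<lambda>x. c' (g x))" "computable d (\<lambda>x. c'' (k x))"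
  shows "computable d (\<lambda>x. h (f x) (g x) (k x))"
  using computable_comp[OF assms(1),
      where gs = "[\<lambda>x. c (f x), \<lambda>x. c' (g x), \<lambda>x. c'' (k x)]" and d = d
      and r = "\<lambda>x. (f x, g x, k x)"] assms(2-4) by auto

lemma computable_zero: "computable d (\<lambda>x. 0)"
  unfolding computable_def by (metis rec_eval.Zero)

lemma computable_Suc: "computable d f \<Longrightarrow> computable d (\<lambda>x. Suc (f x))"
  by (rule computable_comp1[of id Suc]) (auto simp: computable_def intro: rec_eval.Succ)

lemma computable_const: "computable d (\<lambda>x. k)"
  by (induction k) (auto intro: computable_zero computable_Suc)

lemma computable_rec_nat:
  assumes a: "computable d a"
    and g: "computable (\<lambda>z. fst z # fst (snd z) # d (snd (snd z)))
              (\<lambda>z. g (fst z) (fst (snd z)) (snd (snd z)))"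
  shows "computable (\<lambda>z. fst z # d (snd z)) (\<lambda>z. rec_nat (a (snd z)) (\<lambda>n y. g n y (snd z)) (fst z))"
proof -
  obtain p q where p: "\<And>x. rec_eval p (d x) (a x)"
    and q: "\<And>n y x. rec_eval q (n # y # d x) (g n y x)"
    using a g by (fastforce simp: computable_def)
  have "rec_eval (PrimRec p q) (n # d x) (rec_nat (a x) (\<lambda>n y. g n y x) n)" for n x
    by (induction n) (auto intro: rec_eval.PrimRec_0 rec_eval.PrimRec_Suc p q)
  then show ?thesis by (auto simp: computable_def)
qed

text \<open>
  The iterated function works on encoded states of an arbitrary type, and it takes no further
  arguments: anything else that it needs is carried along in the state. Addition, subtraction and
  folds over lists are iterations of this kind.
\<close>

lemma computable_iterate:
  assumes "computable (\<lambda>s. [c s]) (\<lambda>s. c (f s))"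
    and "computable d t" "computable d (\<lambda>x. c (a x))"
  shows "computable d (\<lambda>x. c ((f ^^ t x) (a x)))"
proof -
  obtain q where q: "\<And>s. rec_eval q [c s] (c (f s))"
    using assms(1) by (auto simp: computable_def)
  let ?q = "Comp q [Proj (Suc 0)]"
  have q': "rec_eval ?q [n, c s, m] (c (f s))" for n m s
    using rec_eval.Proj[of "Suc 0" "[n, c s, m]"]
    by (intro rec_eval.Comp[where ys = "[c s]"]) (auto intro: q)
  have p: "rec_eval (Proj 0) [k] k" for k
    using rec_eval.Proj[of 0 "[k]"] by simp
  have "rec_eval (PrimRec (Proj 0) ?q) [n, c s] (c ((f ^^ n) s))" for n s
    by (induction n) (auto intro: rec_eval.PrimRec_0 rec_eval.PrimRec_Suc p q')
  then have "computable (\<lambda>z. [id (fst z), c (snd z)]) (\<lambda>z. c ((f ^^ fst z) (snd z)))"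
    by (auto simp: computable_def)
  from computable_comp2[OF this, of d t a] show ?thesis using assms by simp
qed

lemma computable_add: "computable d f \<Longrightarrow> computable d g \<Longrightarrow> computable d (\<lambda>x. f x + g x)"
proof -
  assume "computable d f" "computable d g"
  moreover have "computable (\<lambda>s. [id s]) (\<lambda>s. id (Suc s))"
    unfolding id_apply by (intro computable_Suc computable_arg[of 0]) simp
  ultimately have "computable d (\<lambda>x. id ((Suc ^^ f x) (g x)))"
    by (intro computable_iterate) auto
  moreover have "(Suc ^^ n) k = n + k" for n k by (induction n) auto
  ultimately show ?thesis by simp
qed

lemma computable_pred: "computable d f \<Longrightarrow> computable d (\<lambda>x. f x - 1)"
proof -
  assume f: "computable d f"
  have "computable (\<lambda>z. fst z # (\<lambda>_. []) (snd z)) (\<lambda>z. rec_nat 0 (\<lambda>n y. n) (fst z))"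
    by (rule computable_rec_nat[where g = "\<lambda>n y x. n"])
      (auto intro: computable_zero computable_arg[of 0])
  then have "computable (\<lambda>n. [id n]) (\<lambda>n. rec_nat 0 (\<lambda>n y. n) n)"
    by (auto simp: computable_def)
  moreover have "rec_nat 0 (\<lambda>n y. n) k = k - 1" for k :: nat by (cases k) auto
  ultimately have "computable (\<lambda>n. [id n]) (\<lambda>n. n - 1)" by simp
  from computable_comp1[OF this, of d f] f show ?thesis by simp
qed

lemma computable_diff: "computable d f \<Longrightarrow> computable d g \<Longrightarrow> computable d (\<lambda>x. f x - g x)"
proof -
  assume "computable d f" "computable d g"
  moreover have "computable (\<lambda>s. [id s]) (\<lambda>s. id (s - 1))"
    unfolding id_apply by (intro computable_pred computable_arg[of 0]) simp
  ultimately have "computable d (\<lambda>x. id (((\<lambda>n. n - 1) ^^ g x) (f x)))"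
    by (intro computable_iterate) auto
  moreover have "((\<lambda>n. n - 1) ^^ n) k = k - n" for n k :: nat by (induction n) auto
  ultimately show ?thesis by simp
qed

lemma computable_not:
  assumes "computable d (\<lambda>x. of_bool (P x))"
  shows "computable d (\<lambda>x. of_bool (\<not> P x))"
proof -
  have "computable d (\<lambda>x. 1 - of_bool (P x))"
    by (intro computable_diff computable_const assms)
  moreover have "(1::nat) - of_bool b = of_bool (\<not> b)" for b by simp
  ultimately show ?thesis by simp
qed

lemma computable_conj:
  assumes "computable d (\<lambda>x. of_bool (P x))" "computable d (\<lambda>x. of_bool (Q x))"
  shows "computable d (\<lambda>x. of_bool (P x \<and> Q x))"
proof -
  have "computable d (\<lambda>x. (of_bool (P x) + of_bool (Q x)) - 1)"
    by (intro computable_diff computable_add computable_const assms)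
  moreover have "(of_bool b + of_bool b') - (1::nat) = of_bool (b \<and> b')" for b b' by simp
  ultimately show ?thesis by simp
qed

lemma computable_disj:
  assumes "computable d (\<lambda>x. of_bool (P x))" "computable d (\<lambda>x. of_bool (Q x))"
  shows "computable d (\<lambda>x. of_bool (P x \<or> Q x))"
  using computable_not[OF computable_conj[OF computable_not[OF assms(1)] computable_not[OF assms(2)]]]
  by simp

lemma computable_eq_0: "computable d f \<Longrightarrow> computable d (\<lambda>x. of_bool (f x = 0))"
proof -
  assume f: "computable d f"
  have "computable d (\<lambda>x. 1 - f x)"
    by (intro computable_diff computable_const f)
  moreover have "(1::nat) - n = of_bool (n = 0)" for n by auto
  ultimately show ?thesis by simp
qed

lemma computable_le:
  "computable d f \<Longrightarrow> computable d g \<Longrightarrow> computable d (\<lambda>x. of_bool (f x \<le> g x))"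
  using computable_eq_0[OF computable_diff[of d f g]] by simp

lemma computable_eq:
  assumes "inj c" "computable d (\<lambda>x. c (f x))" "computable d (\<lambda>x. c (g x))"
  shows "computable d (\<lambda>x. of_bool (f x = g x))"
proof -
  have "computable d (\<lambda>x. of_bool (c (f x) \<le> c (g x) \<and> c (g x) \<le> c (f x)))"
    by (intro computable_conj computable_le assms)
  moreover have "c (f x) \<le> c (g x) \<and> c (g x) \<le> c (f x) \<longleftrightarrow> f x = g x" for x
    using assms(1) by (auto simp: inj_eq)
  ultimately show ?thesis by simp
qed

text \<open>
  Both branches are evaluated before one of them is selected, so both programs have to halt on
  all arguments. A definition by cases without this property is \<open>computable_case_list\<close>.
\<close>

lemma computable_if:
  assumes "computable d (\<lambda>x. of_bool (P x))" "computable d (\<lambda>x. c (f x))" "computable d (\<lambda>x. c (g x))"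
  shows "computable d (\<lambda>x. c (if P x then f x else g x))"
proof -
  have "computable (\<lambda>z. fst z # (\<lambda>z. [fst z, snd z]) (snd z))
      (\<lambda>z. rec_nat (snd (snd z)) (\<lambda>n y. fst (snd z)) (fst z))"
    by (rule computable_rec_nat[where g = "\<lambda>n y x. fst x"])
      (auto intro: computable_arg[of 1] computable_arg[of 2])
  then have "computable (\<lambda>z. [of_bool (fst z), id (fst (snd z)), id (snd (snd z))])
      (\<lambda>z. rec_nat (snd (snd z)) (\<lambda>n y. fst (snd z)) (of_bool (fst z)))"
    by (rule computable_reindex[where r = "\<lambda>z. (of_bool (fst z), snd z)"]) auto
  from computable_comp3[OF this, of d P "\<lambda>x. c (f x)" "\<lambda>x. c (g x)"] assms
  have "computable d (\<lambda>x. rec_nat (c (g x)) (\<lambda>n y. c (f x)) (of_bool (P x)))" by simp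
  moreover have "rec_nat (c (g x)) (\<lambda>n y. c (f x)) (of_bool (P x)) = c (if P x then f x else g x)" for x
    by simp
  ultimately show ?thesis by simp
qed

text \<open>
  The search stops at the first zero, so truth of \<open>Q\<close> is represented by the value 0.
\<close>

lemma rec_eval_Mu_Least:
  assumes p: "\<And>k. rec_eval p (k # xs) (of_bool (\<not> Q k))" and "Q k"
  shows "rec_eval (Mu p) xs (LEAST k. Q k)"
proof (rule rec_eval.Mu)
  show "rec_eval p ((LEAST k. Q k) # xs) 0"
    using p[of "LEAST k. Q k"] LeastI[of Q, OF \<open>Q k\<close>] by simp
next
  fix j assume "j < (LEAST k. Q k)"
  then have "\<not> Q j" by (rule not_less_Least)
  then show "\<exists>y. rec_eval p (j # xs) (Suc y)" using p[of j] by auto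
qed


section \<open>Pairs and lists\<close>

lemma computable_triangle: "computable d f \<Longrightarrow> computable d (\<lambda>x. triangle (f x))"
proof -
  assume f: "computable d f"
  have "computable (\<lambda>z. fst z # (\<lambda>_. []) (snd z)) (\<lambda>z. rec_nat 0 (\<lambda>n y. y + Suc n) (fst z))"
    by (rule computable_rec_nat[where g = "\<lambda>n y x. y + Suc n"])
      (auto intro!: computable_zero computable_add computable_Suc
        intro: computable_arg[of 0] computable_arg[of 1])
  then have "computable (\<lambda>n. [id n]) (\<lambda>n. rec_nat 0 (\<lambda>n y. y + Suc n) n)"
    by (auto simp: computable_def)
  moreover have "rec_nat 0 (\<lambda>n y. y + Suc n) k = triangle k" for k by (induction k) auto
  ultimately have "computable (\<lambda>n. [id n]) triangle" by simp
  from computable_comp1[OF this, of d f] f show ?thesis by simp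
qed

lemma computable_prod_encode:
  "computable d f \<Longrightarrow> computable d g \<Longrightarrow> computable d (\<lambda>x. prod_encode (f x, g x))"
  unfolding prod_encode_def prod.case by (intro computable_add computable_triangle)

text \<open>
  The code of \<open>(a, b)\<close> is \<open>triangle (a + b) + a\<close>, which lies between \<open>triangle (a + b)\<close>
  and \<open>triangle (Suc (a + b))\<close>. Unbounded search therefore recovers \<open>a + b\<close> from the code, and both
  components follow by subtraction.
\<close>

lemma Least_triangle: "(LEAST s. Suc (prod_encode (a, b)) \<le> triangle (Suc s)) = a + b"
proof (rule Least_equality)
  show "Suc (prod_encode (a, b)) \<le> triangle (Suc (a + b))"
    by (simp add: prod_encode_def)
next
  fix s assume s: "Suc (prod_encode (a, b)) \<le> triangle (Suc s)"
  have mono: "triangle m \<le> triangle n" if "m \<le> n" for m n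
    using that by (induction rule: dec_induct) auto
  show "a + b \<le> s"
  proof (rule ccontr)
    assume "\<not> a + b \<le> s"
    then have "triangle (Suc s) \<le> triangle (a + b)" by (intro mono) simp
    with s show False by (simp add: prod_encode_def)
  qed
qed

lemma
  assumes "computable d (\<lambda>x. prod_encode (f x))"
  shows computable_prod_decode_fst: "computable d (\<lambda>x. fst (f x))"
    and computable_prod_decode_snd: "computable d (\<lambda>x. snd (f x))"
proof -
  have "computable (\<lambda>z. [fst z, prod_encode (snd z)])
      (\<lambda>z. of_bool (\<not> Suc (prod_encode (snd z)) \<le> triangle (Suc (fst z))))"
    by (intro computable_not computable_le computable_Suc computable_triangle)
      (auto intro: computable_arg[of 0] computable_arg[of 1])
  then obtain p where p: "\<And>k x. rec_eval p [k, prod_encode x]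
      (of_bool (\<not> Suc (prod_encode x) \<le> triangle (Suc k)))"
    by (fastforce simp: computable_def)
  have "rec_eval (Mu p) [prod_encode (a, b)] (a + b)" for a b
  proof -
    have "Suc (prod_encode (a, b)) \<le> triangle (Suc (a + b))" by (simp add: prod_encode_def)
    from rec_eval_Mu_Least[of p "[prod_encode (a, b)]", OF p this] Least_triangle[of a b]
    show ?thesis by simp
  qed
  then have "computable (\<lambda>y. [prod_encode y]) (\<lambda>y. fst y + snd y)"
    by (auto simp: computable_def)
  from computable_comp1[OF this assms]
  have sum: "computable d (\<lambda>x. fst (f x) + snd (f x))" .
  have "computable d (\<lambda>x. prod_encode (f x) - triangle (fst (f x) + snd (f x)))"
    by (intro computable_diff computable_triangle sum assms)
  then show f: "computable d (\<lambda>x. fst (f x))"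
    by (simp add: prod_encode_def split_beta)
  have "computable d (\<lambda>x. (fst (f x) + snd (f x)) - fst (f x))"
    by (intro computable_diff sum f)
  then show "computable d (\<lambda>x. snd (f x))" by simp
qed

definition pair_code :: "('a \<Rightarrow> nat) \<Rightarrow> ('b \<Rightarrow> nat) \<Rightarrow> 'a \<times> 'b \<Rightarrow> nat" where
  "pair_code c c' z = prod_encode (c (fst z), c' (snd z))"

definition list_code :: "('a \<Rightarrow> nat) \<Rightarrow> 'a list \<Rightarrow> nat" where
  "list_code c xs = list_encode (map c xs)"

lemma computable_Pair:
  "computable d (\<lambda>x. c (f x)) \<Longrightarrow> computable d (\<lambda>x. c' (g x)) \<Longrightarrow>
    computable d (\<lambda>x. pair_code c c' (f x, g x))"
  unfolding pair_code_def fst_conv snd_conv by (rule computable_prod_encode)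

lemma computable_fst: "computable d (\<lambda>x. pair_code c c' (f x)) \<Longrightarrow> computable d (\<lambda>x. c (fst (f x)))"
  unfolding pair_code_def by (drule computable_prod_decode_fst) simp

lemma computable_snd: "computable d (\<lambda>x. pair_code c c' (f x)) \<Longrightarrow> computable d (\<lambda>x. c' (snd (f x)))"
  unfolding pair_code_def by (drule computable_prod_decode_snd) simp

lemma list_code_Nil: "list_code c [] = 0"
  by (simp add: list_code_def)

lemma list_code_Cons: "list_code c (x # xs) = Suc (prod_encode (c x, list_code c xs))"
  by (simp add: list_code_def)

text \<open>
  The code of a list bounds the number of iterations needed to process it.
\<close>

lemma length_le_list_code: "length xs \<le> list_code c xs"
proof (induction xs)
  case (Cons x xs)
  then show ?case
    using le_prod_encode_2[of "list_code c xs" "c x"] by (simp add: list_code_Cons)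
qed simp

lemma computable_Cons:
  "computable d (\<lambda>x. c (f x)) \<Longrightarrow> computable d (\<lambda>x. list_code c (l x)) \<Longrightarrow>
    computable d (\<lambda>x. list_code c (f x # l x))"
  unfolding list_code_Cons by (intro computable_Suc computable_prod_encode)

lemma computable_tl:
  assumes "computable d (\<lambda>x. list_code c (l x))"
  shows "computable d (\<lambda>x. list_code c (tl (l x)))"
proof -
  have "computable d (\<lambda>x. prod_encode (prod_decode (list_code c (l x) - 1)))"
    using computable_pred[OF assms] by simp
  then have "computable d (\<lambda>x. snd (prod_decode (list_code c (l x) - 1)))"
    by (rule computable_prod_decode_snd)
  moreover have "snd (prod_decode (list_code c l - 1)) = list_code c (tl l)" for l
  proof (cases l)
    case Nil
    have "snd (prod_decode 0) = 0"
      by (simp add: prod_decode_def prod_decode_aux.simps)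
    with Nil show ?thesis by (simp add: list_code_Nil)
  qed (simp add: list_code_Cons)
  ultimately show ?thesis by simp
qed

lemma computable_drop:
  assumes "computable d n" "computable d (\<lambda>x. list_code c (l x))"
  shows "computable d (\<lambda>x. list_code c (drop (n x) (l x)))"
proof -
  have "computable d (\<lambda>x. list_code c ((tl ^^ n x) (l x)))"
    by (intro computable_iterate computable_tl computable_arg[of 0] assms) simp
  moreover have "(tl ^^ k) (l x) = drop k (l x)" for k x
    by (induction k) (auto simp: drop_Suc tl_drop)
  ultimately show ?thesis by simp
qed

text \<open>
  The program for \<open>h\<close> may diverge on numbers that do not encode a head and a tail, so it must not be
  run when the list is empty. Primitive recursion on the truth value of \<open>l x \<noteq> []\<close> achieves this: its
  step program runs not at all or exactly once.
\<close>

lemma computable_case_list: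
  assumes g: "computable (\<lambda>x. [c x]) g"
    and h: "computable (\<lambda>z. [c (fst z), e (fst (snd z)), list_code e (snd (snd z))])
              (\<lambda>z. h (fst z) (fst (snd z)) (snd (snd z)))"
    and x: "computable d (\<lambda>x. c (f x))"
    and l: "computable d (\<lambda>x. list_code e (l x))"
  shows "computable d (\<lambda>x. case l x of [] \<Rightarrow> g (f x) | y # ys \<Rightarrow> h (f x) y ys)"
proof -
  obtain p where p: "\<And>x. rec_eval p [c x] (g x)"
    using g by (auto simp: computable_def)
  \<comment> \<open>The arguments of the step program: the counter, which is 0 in the only step, the value for
    the empty list, the parameter, and the code of the list.\<close>
  have "computable (\<lambda>z. [0, fst z, c (fst (snd z)), list_code e (fst (snd (snd z)) # snd (snd (snd z)))])
      (\<lambda>z. h (fst (snd z)) (fst (snd (snd z))) (snd (snd (snd z))))" (is "computable ?d _")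
  proof (rule computable_comp3[OF h])
    show "computable ?d (\<lambda>z. c (fst (snd z)))"
      by (rule computable_arg[of 2]) simp
    have "computable ?d (\<lambda>z. list_code e (fst (snd (snd z)) # snd (snd (snd z))) - 1)"
      by (intro computable_pred computable_arg[of 3]) simp
    then have *: "computable ?d (\<lambda>z. prod_encode (e (fst (snd (snd z))), list_code e (snd (snd (snd z)))))"
      by (simp add: list_code_Cons)
    from computable_prod_decode_fst[OF *] show "computable ?d (\<lambda>z. e (fst (snd (snd z))))"
      by simp
    from computable_prod_decode_snd[OF *] show "computable ?d (\<lambda>z. list_code e (snd (snd (snd z))))"
      by simp
  qed
  then obtain q where q: "\<And>r x y ys. rec_eval q [0, r, c x, list_code e (y # ys)] (h x y ys)"
    unfolding computable_def by (metis fst_conv snd_conv)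
  let ?p = "Comp p [Proj 0]"
  have p': "rec_eval ?p [c x, n] (g x)" for x n
    using rec_eval.Proj[of 0 "[c x, n]"]
    by (intro rec_eval.Comp[where ys = "[c x]"]) (auto intro: p)
  have "rec_eval (PrimRec ?p q) [of_bool (l \<noteq> []), c x, list_code e l]
      (case l of [] \<Rightarrow> g x | y # ys \<Rightarrow> h x y ys)" for x l
  proof (cases l)
    case Nil
    then show ?thesis by (auto intro: rec_eval.PrimRec_0 p')
  next
    case (Cons y ys)
    have "rec_eval (PrimRec ?p q) [Suc 0, c x, list_code e (y # ys)] (h x y ys)"
      by (rule rec_eval.PrimRec_Suc, rule rec_eval.PrimRec_0, rule p', rule q)
    with Cons show ?thesis by simp
  qed
  then have "computable (\<lambda>z. [of_bool (snd z \<noteq> []), c (fst z), list_code e (snd z)])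
      (\<lambda>z. case snd z of [] \<Rightarrow> g (fst z) | y # ys \<Rightarrow> h (fst z) y ys)"
    unfolding computable_def by blast
  note cases = this
  have "computable d (\<lambda>x. of_bool (list_code e (l x) \<noteq> 0))"
    by (intro computable_not computable_eq_0 l)
  moreover have "list_code e (l x) \<noteq> 0 \<longleftrightarrow> l x \<noteq> []" for x
    by (cases "l x") (auto simp: list_code_Nil list_code_Cons)
  ultimately have nonempty: "computable d (\<lambda>x. of_bool (l x \<noteq> []))" by simp
  have "computable d (\<lambda>x. case snd (f x, l x) of [] \<Rightarrow> g (fst (f x, l x))
      | y # ys \<Rightarrow> h (fst (f x, l x)) y ys)"
    by (rule computable_comp[OF cases,
          where gs = "[\<lambda>x. of_bool (l x \<noteq> []), \<lambda>x. c (f x), \<lambda>x. list_code e (l x)]"])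
      (use x l nonempty in auto)
  then show ?thesis unfolding fst_conv snd_conv .
qed

definition fold_step :: "('a \<Rightarrow> 'b \<Rightarrow> 'b) \<Rightarrow> 'b \<times> 'a list \<Rightarrow> 'b \<times> 'a list" where
  "fold_step f z = (case snd z of [] \<Rightarrow> (fst z, []) | y # ys \<Rightarrow> (f y (fst z), ys))"

lemma fst_fold_step_iterate:
  "length ys \<le> n \<Longrightarrow> fst ((fold_step f ^^ n) (s, ys)) = fold f ys s"
proof (induction n arbitrary: s ys)
  case (Suc n)
  then show ?case
    by (cases ys) (auto simp: funpow_Suc_right fold_step_def simp del: funpow.simps)
qed auto

lemma computable_fold:
  assumes f: "computable (\<lambda>z. [e (fst z), c (snd z)]) (\<lambda>z. c (f (fst z) (snd z)))"
    and l: "computable d (\<lambda>x. list_code e (l x))"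
    and a: "computable d (\<lambda>x. c (a x))"
  shows "computable d (\<lambda>x. c (fold f (l x) (a x)))"
proof -
  let ?c = "pair_code c (list_code e)"
  have "computable (\<lambda>z. [?c z]) (\<lambda>z. case snd z of [] \<Rightarrow> ?c (fst z, []) | y # ys \<Rightarrow> ?c (f y (fst z), ys))"
  proof (rule computable_case_list)
    show "computable (\<lambda>s. [c s]) (\<lambda>s. ?c (s, []))"
      by (intro computable_Pair computable_const computable_arg[of 0]) simp
    show "computable (\<lambda>z. [c (fst z), e (fst (snd z)), list_code e (snd (snd z))])
        (\<lambda>z. ?c (f (fst (snd z)) (fst z), snd (snd z)))"
      by (rule computable_Pair, rule computable_comp2[OF f])
        (auto intro: computable_arg[of 0] computable_arg[of 1] computable_arg[of 2])
    show "computable (\<lambda>z. [?c z]) (\<lambda>z. c (fst z))"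
      by (rule computable_fst, rule computable_arg[of 0]) simp
    show "computable (\<lambda>z. [?c z]) (\<lambda>z. list_code e (snd z))"
      by (rule computable_snd, rule computable_arg[of 0]) simp
  qed
  moreover have "(case snd z of [] \<Rightarrow> ?c (fst z, []) | y # ys \<Rightarrow> ?c (f y (fst z), ys)) = ?c (fold_step f z)"
    for z by (simp add: fold_step_def split: list.split)
  ultimately have "computable (\<lambda>z. [?c z]) (\<lambda>z. ?c (fold_step f z))" by simp
  then have "computable d (\<lambda>x. ?c ((fold_step f ^^ list_code e (l x)) (a x, l x)))"
    by (intro computable_iterate computable_Pair l a)
  then have "computable d (\<lambda>x. c (fst ((fold_step f ^^ list_code e (l x)) (a x, l x))))"
    by (rule computable_fst)
  then show ?thesis by (simp add: fst_fold_step_iterate length_le_list_code)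
qed

text \<open>
  The parameter \<open>p x\<close> of the folded function is made a constant component of the state.
\<close>

lemma computable_fold_param:
  assumes f: "computable (\<lambda>z. [k (fst z), e (fst (snd z)), c (snd (snd z))])
        (\<lambda>z. c (f (fst z) (fst (snd z)) (snd (snd z))))"
    and p: "computable d (\<lambda>x. k (p x))"
    and l: "computable d (\<lambda>x. list_code e (l x))"
    and a: "computable d (\<lambda>x. c (a x))"
  shows "computable d (\<lambda>x. c (fold (f (p x)) (l x) (a x)))"
proof -
  let ?c = "pair_code k c" and ?f = "\<lambda>y z. (fst z, f (fst z) y (snd z))"
  have "computable (\<lambda>z. [e (fst z), ?c (snd z)]) (\<lambda>z. ?c (?f (fst z) (snd z)))"
    (is "computable ?d _")
  proof (rule computable_Pair)
    have *: "computable ?d (\<lambda>z. ?c (snd z))" by (rule computable_arg[of 1]) simp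
    show k: "computable ?d (\<lambda>z. k (fst (snd z)))" by (rule computable_fst[OF *])
    show "computable ?d (\<lambda>z. c (f (fst (snd z)) (fst z) (snd (snd z))))"
      by (rule computable_comp3[OF f k _ computable_snd[OF *]], rule computable_arg[of 0]) simp
  qed
  from computable_fold[OF this l] have "computable d (\<lambda>x. ?c (fold ?f (l x) (p x, a x)))"
    by (simp add: computable_Pair p a)
  then have "computable d (\<lambda>x. c (snd (fold ?f (l x) (p x, a x))))"
    by (rule computable_snd)
  moreover have "fold ?f ys (q, s) = (q, fold (f q) ys s)" for q ys s
    by (induction ys arbitrary: s) auto
  ultimately show ?thesis by simp
qed

lemma computable_rev:
  assumes "computable d (\<lambda>x. list_code c (l x))"
  shows "computable d (\<lambda>x. list_code c (rev (l x)))"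
proof -
  have "computable d (\<lambda>x. list_code c (fold Cons (l x) []))"
    by (rule computable_fold[OF _ assms])
      (auto intro!: computable_Cons computable_const intro: computable_arg[of 0] computable_arg[of 1])
  then show ?thesis by (simp add: rev_conv_fold)
qed

lemma surj_pair_code: "surj c \<Longrightarrow> surj c' \<Longrightarrow> surj (pair_code c c')"
  unfolding surj_def pair_code_def
  by (metis fst_conv snd_conv prod_decode_inverse surj_pair)

lemma surj_list_code_id: "surj (list_code id)"
  unfolding surj_def list_code_def by (metis list.map_id0 id_apply list_decode_inverse)

lemma computable_mem:
  assumes "inj c" "computable d (\<lambda>x. c (f x))"
  shows "computable d (\<lambda>x. of_bool (f x \<in> set ys))"
proof (induction ys)
  case (Cons y ys)
  have "computable d (\<lambda>x. of_bool (f x = y))"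
    by (intro computable_eq[OF assms(1)] assms computable_const)
  from computable_disj[OF this Cons] show ?case by simp
qed (simp add: computable_const)

text \<open>
  A number \<open>n\<close> is the code of some \<open>f c\<close> with \<open>P c\<close> exactly if the search for the code of such
  a \<open>c\<close> succeeds. Surjectivity of \<open>e\<close> matters: every candidate has to be the code of some \<open>c\<close>,
  since a test that diverges would block the search. For the same reason the words are values of
  \<open>f\<close>, and \<open>n\<close>, which need not encode a word, is only compared with their codes.
\<close>

lemma re_words_search:
  assumes "surj e" and f: "computable (\<lambda>c. [e c]) (\<lambda>c. word_code (f c))"
    and P: "computable (\<lambda>c. [e c]) (\<lambda>c. of_bool (P c))"
  shows "re_words {f c | c. P c}"
proof -
  have "computable (\<lambda>z. [e (fst z), snd z]) (\<lambda>z. of_bool (word_code (f (fst z)) = snd z \<and> P (fst z)))"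
    (is "computable ?d _")
  proof (rule computable_conj)
    have e: "computable ?d (\<lambda>z. e (fst z))" by (rule computable_arg[of 0]) simp
    show "computable ?d (\<lambda>z. of_bool (P (fst z)))"
      by (rule computable_comp1[OF P e])
    have "computable ?d (\<lambda>z. id (word_code (f (fst z))))"
      using computable_comp1[OF f e] by simp
    then show "computable ?d (\<lambda>z. of_bool (word_code (f (fst z)) = snd z))"
      by (rule computable_eq[OF inj_on_id]) (rule computable_arg[of 1], simp)
  qed
  from computable_not[OF this] obtain p where
    p: "\<And>c n. rec_eval p [e c, n] (of_bool (\<not> (word_code (f c) = n \<and> P c)))"
    by (fastforce simp: computable_def)
  define Q where "Q n k \<longleftrightarrow> word_code (f (inv_into UNIV e k)) = n \<and> P (inv_into UNIV e k)" for n k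
  have p': "rec_eval p [k, n] (of_bool (\<not> Q n k))" for k n
    using p[of "inv_into UNIV e k" n] \<open>surj e\<close> by (simp add: surj_f_inv_f Q_def)
  have "n \<in> word_code ` {f c | c. P c} \<longleftrightarrow> (\<exists>y. rec_eval (Mu p) [n] y)" for n
  proof
    assume "n \<in> word_code ` {f c | c. P c}"
    then obtain c where c: "n = word_code (f c)" "P c" by auto
    have "rec_eval p [e c, n] 0" using p[of c n] c by simp
    with p'[of "e c" n] have "Q n (e c)" by (auto dest: rec_eval_functional)
    with rec_eval_Mu_Least[of p "[n]" "Q n"] p' show "\<exists>y. rec_eval (Mu p) [n] y" by blast
  next
    assume "\<exists>y. rec_eval (Mu p) [n] y"
    then obtain k where "rec_eval p [k, n] 0" by (auto elim: rec_eval_MuE)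
    with p'[of k n] have "Q n k" by (auto dest: rec_eval_functional)
    then show "n \<in> word_code ` {f c | c. P c}" by (auto simp: Q_def)
  qed
  then show ?thesis by (auto simp: re_words_def re_set_def)
qed


section \<open>Computing in free groups\<close>

definition letter_code :: "letter \<Rightarrow> nat" where
  "letter_code = pair_code id of_bool"

lemma word_code_eq_list_code: "word_code = list_code letter_code"
proof -
  have "letter_code = (\<lambda>(i, b). prod_encode (i, of_bool b))"
    by (auto simp: letter_code_def pair_code_def)
  then show ?thesis by (intro ext) (simp only: word_code_def list_code_def)
qed

lemma inj_letter_code: "inj letter_code"
  by (auto simp: inj_def letter_code_def pair_code_def)

lemma computable_inv_letter:
  assumes "computable d (\<lambda>x. letter_code (a x))"
  shows "computable d (\<lambda>x. letter_code (inv_letter (a x)))"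
proof -
  have *: "computable d (\<lambda>x. pair_code id of_bool (a x))"
    using assms by (simp add: letter_code_def)
  show ?thesis
    unfolding letter_code_def inv_letter_def
    by (intro computable_Pair computable_not computable_fst[OF *] computable_snd[OF *])
qed

lemma computable_red_cons:
  assumes "computable d (\<lambda>x. letter_code (a x))" "computable d (\<lambda>x. word_code (w x))"
  shows "computable d (\<lambda>x. word_code (red_cons (a x) (w x)))"
proof -
  have "computable d (\<lambda>x. case w x of [] \<Rightarrow> word_code [a x] | y # v \<Rightarrow>
      word_code (if y = inv_letter (a x) then v else a x # y # v))"
  proof (rule computable_case_list[where c = letter_code])
    show "computable d (\<lambda>x. letter_code (a x))" by fact
    show "computable d (\<lambda>x. list_code letter_code (w x))"
      using assms(2) by (simp add: word_code_eq_list_code)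
    show "computable (\<lambda>x. [letter_code x]) (\<lambda>x. word_code [x])"
      unfolding word_code_eq_list_code
      by (intro computable_Cons computable_const computable_arg[of 0]) simp
    let ?d = "\<lambda>z. [letter_code (fst z), letter_code (fst (snd z)), list_code letter_code (snd (snd z))]"
    have 0: "computable ?d (\<lambda>z. letter_code (fst z))" by (rule computable_arg[of 0]) simp
    have 1: "computable ?d (\<lambda>z. letter_code (fst (snd z)))" by (rule computable_arg[of 1]) simp
    have 2: "computable ?d (\<lambda>z. list_code letter_code (snd (snd z)))"
      by (rule computable_arg[of 2]) simp
    show "computable ?d (\<lambda>z. word_code
        (if fst (snd z) = inv_letter (fst z) then snd (snd z) else fst z # fst (snd z) # snd (snd z)))"
      unfolding word_code_eq_list_code
      by (intro computable_if computable_eq[OF inj_letter_code] computable_inv_letter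
          computable_Cons 0 1 2)
  qed
  then show ?thesis
    by (rule computable_reindex[where r = id]) (auto simp: red_cons_def split: list.split)
qed

lemma computable_word_mult:
  assumes "computable d (\<lambda>x. word_code (u x))" "computable d (\<lambda>x. word_code (v x))"
  shows "computable d (\<lambda>x. word_code (word_mult (u x) (v x)))"
proof -
  have "computable d (\<lambda>x. word_code (fold red_cons (rev (u x)) (v x)))"
    by (rule computable_fold[where e = letter_code], intro computable_red_cons)
      (use assms in \<open>auto simp: word_code_eq_list_code intro: computable_rev
        computable_arg[of 0] computable_arg[of 1]\<close>)
  then show ?thesis by (simp add: word_mult_def foldr_conv_fold)
qed

definition word_inv :: "letter list \<Rightarrow> letter list" where
  "word_inv w = word_mult (rev (map inv_letter w)) []"

lemma computable_word_inv:
  assumes "computable d (\<lambda>x. word_code (w x))"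
  shows "computable d (\<lambda>x. word_code (word_inv (w x)))"
proof -
  have "computable d (\<lambda>x. word_code (fold (\<lambda>x. red_cons (inv_letter x)) (w x) []))"
    by (rule computable_fold[where e = letter_code], intro computable_red_cons computable_inv_letter)
      (use assms in \<open>auto simp: word_code_eq_list_code list_code_Nil
        intro: computable_arg[of 0] computable_arg[of 1] computable_const\<close>)
  then show ?thesis
    by (simp add: word_inv_def word_mult_def foldr_conv_fold fold_map comp_def)
qed

text \<open>
  The number \<open>n\<close> selects a move \<open>(u, v)\<close>, standing for \<open>s \<mapsto> u s v\<close>, from the list. An index beyond
  the end of the list leaves \<open>s\<close> unchanged, so that every list of numbers names an element.
\<close>

definition move :: "(letter list \<times> letter list) list \<Rightarrow> nat \<Rightarrow> letter list \<Rightarrow> letter list" where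
  "move I n s = (case drop n I of [] \<Rightarrow> s | a # _ \<Rightarrow> word_mult (fst a) (word_mult s (snd a)))"

abbreviation moves_code :: "(letter list \<times> letter list) list \<Rightarrow> nat" where
  "moves_code \<equiv> list_code (pair_code word_code word_code)"

lemma computable_run:
  assumes "computable d (\<lambda>x. moves_code (I x))" "computable d (\<lambda>x. list_code id (cs x))"
  shows "computable d (\<lambda>x. word_code (fold (move (I x)) (cs x) []))"
proof (rule computable_fold_param[where k = moves_code and e = id])
  show "computable d (\<lambda>x. moves_code (I x))" "computable d (\<lambda>x. list_code id (cs x))"
    by fact+
  show "computable d (\<lambda>x. word_code [])" by (rule computable_const)
  let ?d = "\<lambda>z. [moves_code (fst z), id (fst (snd z)), word_code (snd (snd z))]"
  have 0: "computable ?d (\<lambda>z. moves_code (fst z))" by (rule computable_arg[of 0]) simp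
  have 1: "computable ?d (\<lambda>z. fst (snd z))" by (rule computable_arg[of 1]) simp
  have 2: "computable ?d (\<lambda>z. word_code (snd (snd z)))" by (rule computable_arg[of 2]) simp
  have "computable ?d (\<lambda>z. case drop (fst (snd z)) (fst z) of [] \<Rightarrow> word_code (snd (snd z))
      | a # _ \<Rightarrow> word_code (word_mult (fst a) (word_mult (snd (snd z)) (snd a))))"
  proof (rule computable_case_list[where c = word_code])
    show "computable ?d (\<lambda>z. word_code (snd (snd z)))" by (rule 2)
    show "computable ?d (\<lambda>z. moves_code (drop (fst (snd z)) (fst z)))"
      by (rule computable_drop[OF 1 0])
    show "computable (\<lambda>s. [word_code s]) word_code" by (rule computable_arg[of 0]) simp
    let ?d = "\<lambda>z. [word_code (fst z), pair_code word_code word_code (fst (snd z)), moves_code (snd (snd z))]"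
    have 0: "computable ?d (\<lambda>z. word_code (fst z))" by (rule computable_arg[of 0]) simp
    have 1: "computable ?d (\<lambda>z. pair_code word_code word_code (fst (snd z)))"
      by (rule computable_arg[of 1]) simp
    show "computable ?d (\<lambda>z. word_code (word_mult (fst (fst (snd z)))
        (word_mult (fst z) (snd (fst (snd z))))))"
      by (intro computable_word_mult computable_fst[OF 1] computable_snd[OF 1] 0)
  qed
  then show "computable ?d (\<lambda>z. word_code (move (fst z) (fst (snd z)) (snd (snd z))))"
    by (rule computable_reindex[where r = id]) (auto simp: move_def split: list.split)
qed


section \<open>Normal closures as orbits\<close>

inductive_set orbit :: "('a, 'b) monoid_scheme \<Rightarrow> ('a \<times> 'a) set \<Rightarrow> 'a set"
  for G :: "('a, 'b) monoid_scheme" and M :: "('a \<times> 'a) set" where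
  one: "\<one>\<^bsub>G\<^esub> \<in> orbit G M"
| move: "s \<in> orbit G M \<Longrightarrow> (u, v) \<in> M \<Longrightarrow> u \<otimes>\<^bsub>G\<^esub> (s \<otimes>\<^bsub>G\<^esub> v) \<in> orbit G M"

definition left_moves :: "('a, 'b) monoid_scheme \<Rightarrow> 'a set \<Rightarrow> ('a \<times> 'a) set" where
  "left_moves G R = (\<lambda>r. (r, \<one>\<^bsub>G\<^esub>)) ` R"

definition conj_moves :: "('a, 'b) monoid_scheme \<Rightarrow> 'a set \<Rightarrow> ('a \<times> 'a) set" where
  "conj_moves G X = (\<lambda>x. (x, inv\<^bsub>G\<^esub> x)) ` X"

lemma (in group) orbit_left_moves_subset_generate:
  assumes "X \<subseteq> carrier G"
  shows "orbit G (left_moves G X) \<subseteq> generate G X"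
proof
  fix s assume "s \<in> orbit G (left_moves G X)"
  then show "s \<in> generate G X"
  proof induction
    case one show ?case by (rule generate.one)
  next
    case (move s u v)
    then have "u \<in> X" "v = \<one>" by (auto simp: left_moves_def)
    with move show ?case
      using generate_in_carrier[OF assms] by (auto intro: generate.eng generate.incl)
  qed
qed

text \<open>
  Every normal subgroup contains the identity and is preserved by conjugation and by
  multiplication with its own elements, hence by all moves.
\<close>

lemma (in group) orbit_subset_normal:
  assumes "N \<lhd> G" "X \<subseteq> carrier G" "R \<subseteq> N"
  shows "orbit G (left_moves G R \<union> conj_moves G X) \<subseteq> N"
proof
  interpret N: normal N G by fact
  fix s assume "s \<in> orbit G (left_moves G R \<union> conj_moves G X)"
  then show "s \<in> N"
  proof induction
    case (move s u v)
    from move(2) consider "u \<in> R" "v = \<one>" | "u \<in> X" "v = inv u"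
      by (auto simp: left_moves_def conj_moves_def)
    then show ?case
    proof cases
      case 1
      with assms move(3) show ?thesis by auto
    next
      case 2
      with assms(2) move(3) show ?thesis
        using N.inv_op_closed2[of u s] by (auto simp: m_assoc)
    qed
  qed simp
qed

text \<open>
  Conversely, such an orbit is itself a normal subgroup. The moves are deliberately few: conjugation
  by generators only and multiplication on the left only. Products, inverses and conjugation by
  arbitrary elements are recovered by induction.
\<close>

context group
begin

context
  fixes R X C
  assumes R: "R \<subseteq> carrier G" "\<And>r. r \<in> R \<Longrightarrow> inv r \<in> R"
    and X: "X \<subseteq> carrier G" "\<And>x. x \<in> X \<Longrightarrow> inv x \<in> X" "generate G X = carrier G"
  defines "C \<equiv> orbit G (left_moves G R \<union> conj_moves G X)"
begin

lemma orbit_mult_relator: "r \<in> R \<Longrightarrow> s \<in> C \<Longrightarrow> r \<otimes> (s \<otimes> \<one>) \<in> C"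
  unfolding C_def by (rule orbit.move) (auto simp: left_moves_def)

lemma orbit_conj_generator: "x \<in> X \<Longrightarrow> s \<in> C \<Longrightarrow> x \<otimes> (s \<otimes> inv x) \<in> C"
  unfolding C_def by (rule orbit.move) (auto simp: conj_moves_def)

lemma orbit_induct [consumes 1, case_names one relator conjugate]:
  assumes "s \<in> C" "P \<one>"
    and "\<And>r s. r \<in> R \<Longrightarrow> s \<in> C \<Longrightarrow> s \<in> carrier G \<Longrightarrow> P s \<Longrightarrow> P (r \<otimes> s)"
    and "\<And>x s. x \<in> X \<Longrightarrow> s \<in> C \<Longrightarrow> s \<in> carrier G \<Longrightarrow> P s \<Longrightarrow> P (x \<otimes> (s \<otimes> inv x))"
  shows "P s"
proof -
  have "s \<in> carrier G \<and> P s"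
    using assms(1) unfolding C_def
  proof induction
    case (move s u v)
    from move(2) consider "u \<in> R" "v = \<one>" | "u \<in> X" "v = inv u"
      by (auto simp: left_moves_def conj_moves_def)
    then show ?case
      using move R(1) X(1) assms(3,4)[of u s, folded C_def] by cases (auto simp: C_def)
  qed (auto intro: assms(2))
  then show ?thesis ..
qed

lemma orbit_subset_carrier: "s \<in> C \<Longrightarrow> s \<in> carrier G"
  by (induction rule: orbit_induct) (use R(1) X(1) in auto)

lemma relators_subset_orbit: "R \<subseteq> C"
proof
  fix r assume "r \<in> R"
  moreover from this have "r \<in> carrier G" using R(1) by blast
  ultimately show "r \<in> C"
    using orbit_mult_relator[of r \<one>] by (auto simp: C_def intro: orbit.one)
qed

text \<open>
  Induction on the first factor. For a conjugate \<open>x s x\<inverse>\<close>, the identity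
  \<open>x s x\<inverse> t = x (s (x\<inverse> t x)) x\<inverse>\<close> leads back to \<open>s\<close>, because the orbit is closed under conjugation
  by the generator \<open>x\<inverse>\<close>; the second factor changes and has to be kept arbitrary.
\<close>

lemma orbit_mult: "s \<in> C \<Longrightarrow> t \<in> C \<Longrightarrow> s \<otimes> t \<in> C"
proof (induction s arbitrary: t rule: orbit_induct)
  case one
  then show ?case using orbit_subset_carrier by simp
next
  case (relator r s)
  then have "r \<otimes> (s \<otimes> t \<otimes> \<one>) \<in> C" by (intro orbit_mult_relator) auto
  with relator R(1) show ?case using orbit_subset_carrier by (auto simp: m_assoc subset_iff)
next
  case (conjugate x s)
  have x: "x \<in> carrier G" and t: "t \<in> carrier G"
    using conjugate X(1) orbit_subset_carrier by auto
  have "inv x \<otimes> (t \<otimes> inv (inv x)) \<in> C"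
    using conjugate X by (intro orbit_conj_generator) auto
  then have "s \<otimes> (inv x \<otimes> (t \<otimes> inv (inv x))) \<in> C"
    by (rule conjugate.IH)
  then have "x \<otimes> (s \<otimes> (inv x \<otimes> (t \<otimes> inv (inv x))) \<otimes> inv x) \<in> C"
    by (rule orbit_conj_generator[OF \<open>x \<in> X\<close>])
  also have "x \<otimes> (s \<otimes> (inv x \<otimes> (t \<otimes> inv (inv x))) \<otimes> inv x) = x \<otimes> (s \<otimes> inv x) \<otimes> t"
    using x t conjugate.hyps by (simp add: m_assoc)
  finally show ?case .
qed

lemma orbit_inv: "s \<in> C \<Longrightarrow> inv s \<in> C"
proof (induction rule: orbit_induct)
  case one
  then show ?case by (simp add: C_def orbit.one)
next
  case (relator r s)
  have "inv s \<otimes> inv r \<in> C"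
    using relator R(2) relators_subset_orbit by (intro orbit_mult) auto
  with relator R(1) show ?case by (auto simp: inv_mult_group)
next
  case (conjugate x s)
  have "x \<otimes> (inv s \<otimes> inv x) \<in> C" using conjugate by (intro orbit_conj_generator)
  with conjugate X(1) show ?case by (auto simp: inv_mult_group m_assoc subset_iff)
qed

lemma orbit_conj:
  assumes "g \<in> carrier G" "s \<in> C"
  shows "g \<otimes> s \<otimes> inv g \<in> C"
proof -
  have "g \<in> generate G X" using assms X by simp
  then show ?thesis using \<open>s \<in> C\<close>
  proof (induction arbitrary: s)
    case one
    then show ?case using orbit_subset_carrier by simp
  next
    case (incl x)
    then show ?case
      using orbit_conj_generator[of x s] orbit_subset_carrier[of s] X(1) by (auto simp: m_assoc)
  next
    case (inv x)
    then show ?case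
      using orbit_conj_generator[of "inv x" s] orbit_subset_carrier[of s] X
      by (auto simp: m_assoc subset_iff)
  next
    case (eng g h)
    then have "g \<otimes> (h \<otimes> s \<otimes> inv h) \<otimes> inv g \<in> C" by blast
    moreover have "g \<in> carrier G" "h \<in> carrier G" using eng X by auto
    ultimately show ?case
      using orbit_subset_carrier[of s] eng.prems by (simp add: inv_mult_group m_assoc)
  qed
qed

lemma normal_orbit: "C \<lhd> G"
  unfolding normal_inv_iff
  using orbit_subset_carrier orbit_mult orbit_inv orbit_conj
  by (auto intro!: subgroupI) (auto simp: C_def intro: orbit.one)

end

end

section \<open>Enumerating normal closures in free groups\<close>

definition letters :: "nat \<Rightarrow> letter list list" where
  "letters m = map (\<lambda>x. [x]) (List.product [0..<m] [True, False])"

lemma set_letters: "set (letters m) = {[x] | x. fst x < m}"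
  by (auto simp: letters_def)

lemma letters_in_free_group: "set (letters m) \<subseteq> carrier (free_group m)"
  by (auto simp: set_letters free_group_def reduced_def)

lemma inv_free_group:
  assumes "w \<in> carrier (free_group m)"
  shows "inv\<^bsub>free_group m\<^esub> w = word_inv w"
proof (rule group.inv_equality[OF group_free_group])
  show "word_inv w \<otimes>\<^bsub>free_group m\<^esub> w = \<one>\<^bsub>free_group m\<^esub>"
    using assms word_mult_rev_inv[of "[]" w]
    by (simp add: word_inv_def word_mult_assoc free_group_def word_mult_Nil)
  have "set (word_inv w) \<subseteq> inv_letter ` set w"
    using set_word_mult[of "rev (map inv_letter w)" "[]"] by (simp add: word_inv_def)
  then have "fst ` set (word_inv w) \<subseteq> fst ` inv_letter ` set w"
    by (rule image_mono)
  with assms show "word_inv w \<in> carrier (free_group m)"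
    by (auto simp: free_group_def word_inv_def reduced_word_mult image_image)
qed (fact assms)

lemma word_inv_letter: "word_inv [x] = [inv_letter x]"
  by (simp add: word_inv_def red_cons_def)

lemma inv_letters:
  assumes "x \<in> set (letters m)"
  shows "inv\<^bsub>free_group m\<^esub> x \<in> set (letters m)"
proof -
  have "x \<in> carrier (free_group m)" using assms letters_in_free_group by blast
  with assms show ?thesis by (auto simp: inv_free_group set_letters word_inv_letter inv_letter_def)
qed

definition generator_moves :: "nat \<Rightarrow> (letter list \<times> letter list) list" where
  "generator_moves m = map (\<lambda>x. (x, [])) (letters m)"

lemma set_generator_moves: "set (generator_moves m) = left_moves (free_group m) (set (letters m))"
  by (simp add: generator_moves_def left_moves_def free_group_def)

text \<open>
  A reduced word is built from its last letter to its first, and no cancellation occurs.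
\<close>

lemma carrier_subset_orbit_generator_moves:
  "carrier (free_group m) \<subseteq> orbit (free_group m) (set (generator_moves m))"
proof
  fix w assume "w \<in> carrier (free_group m)"
  then show "w \<in> orbit (free_group m) (set (generator_moves m))"
  proof (induction w)
    case Nil
    show ?case using orbit.one[of "free_group m"] by (simp add: free_group_def)
  next
    case (Cons x w)
    then have w: "reduced (x # w)" "fst x < m" "w \<in> carrier (free_group m)"
      using reduced_ConsD[of x w] by (auto simp: free_group_def)
    then have "([x], []) \<in> set (generator_moves m)"
      by (cases x) (auto simp: generator_moves_def set_letters)
    from orbit.move[OF Cons.IH[OF w(3)] this] w show ?case
      by (simp add: free_group_def word_mult_Nil red_cons_reduced)
  qed
qed

lemma orbit_generator_moves:
    "orbit (free_group m) (set (generator_moves m)) = carrier (free_group m)"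
  and generate_letters: "generate (free_group m) (set (letters m)) = carrier (free_group m)"
proof -
  interpret group "free_group m" by (rule group_free_group)
  have "orbit (free_group m) (set (generator_moves m)) \<subseteq> generate (free_group m) (set (letters m))"
    unfolding set_generator_moves
    by (rule orbit_left_moves_subset_generate[OF letters_in_free_group])
  moreover have "generate (free_group m) (set (letters m)) \<subseteq> carrier (free_group m)"
    by (rule generate_incl[OF letters_in_free_group])
  ultimately show "orbit (free_group m) (set (generator_moves m)) = carrier (free_group m)"
    "generate (free_group m) (set (letters m)) = carrier (free_group m)"
    using carrier_subset_orbit_generator_moves by blast+
qed

definition closure_moves :: "nat \<Rightarrow> letter list list \<Rightarrow> (letter list \<times> letter list) list" where
  "closure_moves m rs =
     concat (map (\<lambda>r. [(r, []), (word_inv r, [])]) rs) @ map (\<lambda>x. (x, word_inv x)) (letters m)"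

lemma set_closure_moves:
  assumes "set rs \<subseteq> carrier (free_group m)"
  shows "set (closure_moves m rs) =
    left_moves (free_group m) (set rs \<union> (\<lambda>r. inv\<^bsub>free_group m\<^esub> r) ` set rs)
      \<union> conj_moves (free_group m) (set (letters m))"
proof -
  have "(\<lambda>r. inv\<^bsub>free_group m\<^esub> r) ` set rs = word_inv ` set rs"
    using assms inv_free_group by (intro image_cong) auto
  moreover have "(\<lambda>x. (x, inv\<^bsub>free_group m\<^esub> x)) ` set (letters m) = (\<lambda>x. (x, word_inv x)) ` set (letters m)"
    using letters_in_free_group inv_free_group by (intro image_cong) auto
  ultimately show ?thesis
    by (auto simp: closure_moves_def left_moves_def conj_moves_def free_group_def)
qed

text \<open>
  The orbit is the least normal subgroup containing the relators.
\<close>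

lemma normal_closure_orbit:
  assumes "set rs \<subseteq> carrier (free_group m)"
  defines "C \<equiv> orbit (free_group m) (set (closure_moves m rs))"
  shows "C \<lhd> free_group m" "set rs \<subseteq> C"
    and "N \<lhd> free_group m \<Longrightarrow> set rs \<subseteq> N \<Longrightarrow> C \<subseteq> N"
proof -
  interpret group "free_group m" by (rule group_free_group)
  let ?R = "set rs \<union> (\<lambda>r. inv\<^bsub>free_group m\<^esub> r) ` set rs"
  have R: "?R \<subseteq> carrier (free_group m)" "\<And>r. r \<in> ?R \<Longrightarrow> inv\<^bsub>free_group m\<^esub> r \<in> ?R"
    using assms(1) by (auto simp: subset_iff)
  note * = normal_orbit[OF R letters_in_free_group inv_letters generate_letters]
    relators_subset_orbit[OF R letters_in_free_group inv_letters generate_letters]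
  show "C \<lhd> free_group m" "set rs \<subseteq> C"
    using * by (simp_all add: C_def set_closure_moves[OF assms(1)])
  assume N: "N \<lhd> free_group m" "set rs \<subseteq> N"
  then interpret N: normal N "free_group m" by simp
  have "?R \<subseteq> N" using N(2) by auto
  then show "C \<subseteq> N"
    unfolding C_def set_closure_moves[OF assms(1)]
    by (rule orbit_subset_normal[OF N(1) letters_in_free_group])
qed

lemma range_run: "range (\<lambda>cs. fold (move I) cs []) = orbit (free_group m) (set I)"
proof (intro subset_antisym subsetI)
  fix s assume "s \<in> range (\<lambda>cs. fold (move I) cs [])"
  then obtain cs where s: "s = fold (move I) cs []" by auto
  have "move I n s \<in> orbit (free_group m) (set I)"
    if s: "s \<in> orbit (free_group m) (set I)" for n s
  proof (cases "drop n I")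
    case (Cons a l)
    then have "a \<in> set I" by (metis in_set_dropD list.set_intros(1))
    with Cons orbit.move[OF s, of "fst a" "snd a"] show ?thesis
      by (simp add: move_def free_group_def)
  qed (simp add: move_def s)
  then have "fold (move I) cs t \<in> orbit (free_group m) (set I)"
    if "t \<in> orbit (free_group m) (set I)" for t
    using that by (induction cs arbitrary: t) auto
  moreover have "[] \<in> orbit (free_group m) (set I)"
    using orbit.one[of "free_group m"] by (simp add: free_group_def)
  ultimately show "s \<in> orbit (free_group m) (set I)" using s by blast
next
  fix s assume "s \<in> orbit (free_group m) (set I)"
  then show "s \<in> range (\<lambda>cs. fold (move I) cs [])"
  proof induction
    case one
    show ?case by (rule range_eqI[of _ _ "[]"]) (simp add: free_group_def)
  next
    case (move s u v)
    then obtain cs n where s: "s = fold (move I) cs []" and n: "n < length I" "I ! n = (u, v)"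
      by (auto simp: in_set_conv_nth)
    have "drop n I = (u, v) # drop (Suc n) I"
      using n by (metis Cons_nth_drop_Suc)
    then have "move I n t = word_mult u (word_mult t v)" for t
      by (simp add: move_def)
    then show ?case
      by (intro range_eqI[of _ _ "cs @ [n]"]) (simp add: s free_group_def)
  qed
qed

lemma re_words_orbit: "re_words (orbit (free_group m) (set I))"
proof -
  have "re_words {fold (move I) cs [] | cs. True}"
  proof (rule re_words_search[OF surj_list_code_id])
    show "computable (\<lambda>cs. [list_code id cs]) (\<lambda>cs. word_code (fold (move I) cs []))"
      by (rule computable_run[OF computable_const computable_arg[of 0]]) simp
    show "computable (\<lambda>cs. [list_code id cs]) (\<lambda>cs. of_bool True)"
      by (rule computable_const)
  qed
  moreover have "{fold (move I) cs [] | cs. True} = orbit (free_group m) (set I)"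
    using range_run[of I m] by auto
  ultimately show ?thesis by simp
qed

text \<open>
  The search runs over pairs of names: the first names a word \<open>w\<close> of the free group, the second an
  element of the normal closure of \<open>rs\<close> and \<open>w\<close>. Since the generator moves reach
  exactly the elements of the free group, no test is needed whether \<open>w\<close> is reduced and
  uses only the first \<open>m\<close> generators.
\<close>

lemma re_words_closure_meets:
  "re_words {w \<in> carrier (free_group m).
    orbit (free_group m) (set (closure_moves m (w # rs))) \<inter> set qs \<noteq> {}}"
proof -
  let ?w = "\<lambda>z. fold (move (generator_moves m)) (fst z) []"
  let ?I = "\<lambda>z. closure_moves m (?w z # rs)"
  let ?c = "pair_code (list_code id) (list_code id)"
  let ?P = "\<lambda>z. fold (move (?I z)) (snd z) [] \<in> set qs"
  have "re_words {?w z | z. ?P z}"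
  proof (rule re_words_search)
    show "surj ?c" by (intro surj_pair_code surj_list_code_id)
    have z: "computable (\<lambda>z. [?c z]) ?c" by (rule computable_arg[of 0]) simp
    show w: "computable (\<lambda>z. [?c z]) (\<lambda>z. word_code (?w z))"
      by (rule computable_run[OF computable_const computable_fst[OF z]])
    have "computable (\<lambda>z. [?c z]) (\<lambda>z. moves_code
        ((?w z, []) # (word_inv (?w z), []) # closure_moves m rs))"
      by (intro computable_Cons computable_Pair computable_word_inv computable_const w)
    then have I: "computable (\<lambda>z. [?c z]) (\<lambda>z. moves_code (?I z))"
      by (simp add: closure_moves_def)
    show "computable (\<lambda>z. [?c z]) (\<lambda>z. of_bool (?P z))"
      by (rule computable_mem[OF inj_word_code computable_run[OF I computable_snd[OF z]]])
  qed
  moreover have "{?w z | z. ?P z} = {w \<in> carrier (free_group m).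
    orbit (free_group m) (set (closure_moves m (w # rs))) \<inter> set qs \<noteq> {}}"
    unfolding orbit_generator_moves[symmetric] range_run[symmetric] by (auto 0 4)
  ultimately show ?thesis by simp
qed


section \<open>Isolated groups\<close>

text \<open>
  A basic open neighbourhood of \<open>N\<close> restricts only finitely many coordinates; \<open>K\<close> is the set of
  these.
\<close>

lemma open_singleton_finite_test:
  assumes "openin (marked_groups m) {N}"
  obtains K where "finite K" "K \<subseteq> carrier (free_group m)"
    "\<And>N'. N' \<lhd> free_group m \<Longrightarrow> N' \<inter> K = N \<inter> K \<Longrightarrow> N' = N"
proof -
  let ?F = "carrier (free_group m)"
  let ?T = "\<lambda>_ :: letter list. discrete_topology (UNIV :: bool set)"
  let ?f = "\<lambda>N. \<lambda>w\<in>?F. w \<in> N"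
  obtain V where V: "openin (product_topology ?T ?F) V" "{N} = ?f -` V \<inter> {N. N \<lhd> free_group m}"
    using assms by (auto simp: marked_groups_def openin_pullback_topology)
  then have "?f N \<in> V" by blast
  with V(1) obtain U where U: "finite {w \<in> ?F. U w \<noteq> UNIV}" "?f N \<in> Pi\<^sub>E ?F U" "Pi\<^sub>E ?F U \<subseteq> V"
    unfolding openin_product_topology_alt by fastforce
  show thesis
  proof (rule that[of "{w \<in> ?F. U w \<noteq> UNIV}"])
    fix N' assume N': "N' \<lhd> free_group m"
      and eq: "N' \<inter> {w \<in> ?F. U w \<noteq> UNIV} = N \<inter> {w \<in> ?F. U w \<noteq> UNIV}"
    have "(w \<in> N') \<in> U w" if w: "w \<in> ?F" for w
    proof (cases "U w = UNIV")
      case False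
      then have "w \<in> N' \<longleftrightarrow> w \<in> N" using w eq by blast
      moreover have "(w \<in> N) \<in> U w" using U(2) w by (auto simp: PiE_iff)
      ultimately show ?thesis by simp
    qed simp
    then have "?f N' \<in> V" using U(3) by (auto simp: PiE_iff)
    with V(2) N' show "N' = N" by blast
  qed (use U(1) in auto)
qed

text \<open>
  The elements \<open>ps\<close> of \<open>K\<close> in \<open>N\<close> generate \<open>N\<close> as a normal subgroup, and the elements \<open>qs\<close> of \<open>K\<close>
  outside \<open>N\<close> detect every proper normal enlargement of \<open>N\<close>.
\<close>

lemma recursive_if_isolated:
  assumes N: "N \<lhd> free_group m" and "openin (marked_groups m) {N}"
  shows "recursive_in_free_group m N"
proof -
  from open_singleton_finite_test[OF assms(2)] obtain K
    where K: "finite K" "K \<subseteq> carrier (free_group m)"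
      and test: "\<And>N'. N' \<lhd> free_group m \<Longrightarrow> N' \<inter> K = N \<inter> K \<Longrightarrow> N' = N"
    by metis
  obtain ps qs where ps: "set ps = K \<inter> N" and qs: "set qs = K - N"
    using K(1) by (metis finite_Diff finite_Int finite_list)
  let ?ncl = "\<lambda>rs. orbit (free_group m) (set (closure_moves m rs))"
  have P: "set ps \<subseteq> carrier (free_group m)" using K(2) ps by blast
  have "?ncl ps = N"
  proof (rule test[OF normal_closure_orbit(1)[OF P]])
    have "?ncl ps \<subseteq> N" using normal_closure_orbit(3)[OF P N] ps by blast
    then show "?ncl ps \<inter> K = N \<inter> K" using normal_closure_orbit(2)[OF P] ps by blast
  qed
  then have "re_words N" using re_words_orbit by metis
  moreover have "?ncl (w # ps) \<inter> set qs \<noteq> {} \<longleftrightarrow> w \<notin> N" if "w \<in> carrier (free_group m)" for w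
  proof -
    have W: "set (w # ps) \<subseteq> carrier (free_group m)" using P that by simp
    show ?thesis
    proof
      assume "?ncl (w # ps) \<inter> set qs \<noteq> {}"
      then show "w \<notin> N" using normal_closure_orbit(3)[OF W N] ps qs by auto
    next
      assume "w \<notin> N"
      then have "?ncl (w # ps) \<noteq> N" using normal_closure_orbit(2)[OF W] by auto
      then have "?ncl (w # ps) \<inter> K \<noteq> N \<inter> K" using test[OF normal_closure_orbit(1)[OF W]] by blast
      then show "?ncl (w # ps) \<inter> set qs \<noteq> {}"
        using normal_closure_orbit(2)[OF W] ps qs by auto
    qed
  qed
  then have "carrier (free_group m) - N
      = {w \<in> carrier (free_group m). ?ncl (w # ps) \<inter> set qs \<noteq> {}}"
    by blast
  ultimately show ?thesis
    using re_words_closure_meets by (simp add: recursive_in_free_group_def)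
qed

theorem corollary5:
  fixes G :: "('a, 'b) monoid_scheme"
  assumes "group G"
    and "isolated_group G"
  shows "solvable_word_problem G"
  using assms(2) recursive_if_isolated
  unfolding isolated_group_def solvable_word_problem_def by blast

end
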